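(* Let $(X,\mu)$ be a probability space, let $f\in L_1(X)$, and let $m\ge1$ be an integer. For every measurable set $\Delta\subset X$ with $|\Delta|:=\mu\Delta>0$, $$\|f\|_{m,\infty}\ge\big(1-(1-|\Delta|)^m\big)\cdot\frac1{|\Delta|}\int_\Delta|f|\,d\mu.$$
   Context: For a probability space $(X,\mu)$, an integer $m\ge1$ and an integrable function $f$ on $X$, the integral-uniform norm is $$\|f\|_{m,\infty}:=\int_X\cdots\int_X\max\{|f(x_1)|,\dots,|f(x_m)|\}\,d\mu(x_1)\cdots d\mu(x_m).$$ *)

theory Defs
  imports "HOL-Probability.Probability_Measure"
begin

(* The m-fold integral is taken over the product space X^m with the product measure.  For a
   probability space M and integrable f the integrand is dominated by the sum of the
   norm (f (x i)), hence integrable, and by Fubini this is the iterated integral.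
   Only m >= 1 is meaningful: Max of the empty set is unspecified.  The class constraints on
   the codomain admit both real- and complex-valued f. *)
definition integral_uniform_norm ::
  "'a measure \<Rightarrow> nat \<Rightarrow> ('a \<Rightarrow> 'b::{real_normed_field, banach, second_countable_topology}) \<Rightarrow> real"
  where "integral_uniform_norm M m f =
    (\<integral>x. (MAX i\<in>{1..m}. norm (f (x i))) \<partial>(Pi\<^sub>M {1..m} (\<lambda>_. M)))"

end

theory Submission
  imports Defs "HOL-Probability.Infinite_Product_Measure"
begin

text \<open>
  Let \<open>\<delta>\<close> be the measure of \<open>\<Delta>\<close>. For a point \<open>x\<close> of the product space that has a coordinate in
  \<open>\<Delta>\<close>, let \<open>j\<close> be the \<^emph>\<open>first\<close> index with \<open>x j \<in> \<Delta>\<close>. The maximum of the \<open>norm (f (x i))\<close> is at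
  least \<open>norm (f (x j))\<close> (\<open>sum_first_hit_le_Max\<close>). That \<open>j\<close> is the first such index means that
  the earlier coordinates miss \<open>\<Delta>\<close> and \<open>x j\<close> hits it; by independence of the coordinates this
  event contributes \<open>(1 - \<delta>) ^ (j - 1)\<close> times the integral of \<open>norm (f y)\<close> over \<open>\<Delta>\<close>. These events are disjoint, so the contributions add up, and the
  geometric sum over \<open>j\<close> is \<open>(1 - (1 - \<delta>) ^ m) / \<delta>\<close>.

  The value of \<open>norm (f (x j))\<close> on the event that \<open>j\<close> is the first index is written as a product
  over all coordinates (\<open>first_hit_factor\<close>), so that its integral splits by Fubini
  (\<open>integral_prod_first_hit_factor\<close>).
\<close>

text \<open>
  For \<open>j\<close> in \<open>{1..m}\<close>, the product over all \<open>i\<close> in \<open>{1..m}\<close> of these factors at \<open>x i\<close> is \<open>h (x j)\<close>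
  if \<open>j\<close> is the first index in that range with \<open>x j \<in> A\<close>, and \<open>0\<close> otherwise. Coordinates after
  the first hit are unconstrained, hence the factor \<open>1\<close>.
\<close>

definition first_hit_factor :: "'a set \<Rightarrow> ('a \<Rightarrow> real) \<Rightarrow> nat \<Rightarrow> nat \<Rightarrow> 'a \<Rightarrow> real" where
  "first_hit_factor A h j i y =
    (if i < j then 1 - indicator A y else if i = j then indicator A y * h y else 1)"

text \<open>
  Only the summand of the first index \<open>j\<close> with \<open>x j \<in> A\<close> can be nonzero, and it is \<open>h (x j)\<close>.
  If no coordinate lies in \<open>A\<close>, the sum vanishes and nonnegativity of \<open>h\<close> gives the bound.
\<close>

lemma sum_first_hit_le_Max:
  fixes h :: "'a \<Rightarrow> real"
  assumes "m \<ge> 1" and nonneg: "\<And>y. h y \<ge> 0"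
  shows "(\<Sum>j\<in>{1..m}. \<Prod>i\<in>{1..m}. first_hit_factor A h j i (x i)) \<le> (MAX i\<in>{1..m}. h (x i))"
proof (cases "\<exists>j\<in>{1..m}. x j \<in> A")
  case False
  have "(\<Prod>i\<in>{1..m}. first_hit_factor A h j i (x i)) = 0" if "j \<in> {1..m}" for j
    using False that by (intro prod_zero) (auto simp: first_hit_factor_def intro!: bexI[of _ j])
  then have "(\<Sum>j\<in>{1..m}. \<Prod>i\<in>{1..m}. first_hit_factor A h j i (x i)) = 0"
    by (intro sum.neutral ballI)
  also have "0 \<le> h (x 1)" by (rule nonneg)
  also have "h (x 1) \<le> (MAX i\<in>{1..m}. h (x i))"
    using \<open>m \<ge> 1\<close> by (intro Max_ge) auto
  finally show ?thesis .
next
  case True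
  define k where "k = (LEAST j. j \<in> {1..m} \<and> x j \<in> A)"
  have k: "k \<in> {1..m}" "x k \<in> A"
    using LeastI_ex[of "\<lambda>j. j \<in> {1..m} \<and> x j \<in> A"] True unfolding k_def by blast+
  have below: "x i \<notin> A" if "i \<in> {1..m}" "i < k" for i
    using not_less_Least[of i "\<lambda>j. j \<in> {1..m} \<and> x j \<in> A"] that unfolding k_def by blast
  have other: "(\<Prod>i\<in>{1..m}. first_hit_factor A h j i (x i)) = 0" if "j \<in> {1..m}" "j \<noteq> k" for j
  proof (cases "j < k")
    case True
    then show ?thesis using that below[of j]
      by (intro prod_zero) (auto simp: first_hit_factor_def intro!: bexI[of _ j])
  next
    case False
    then show ?thesis using that k
      by (intro prod_zero) (auto simp: first_hit_factor_def intro!: bexI[of _ k])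
  qed
  have "(\<Prod>i\<in>{1..m}. first_hit_factor A h k i (x i)) = (\<Prod>i\<in>{1..m}. if i = k then h (x k) else 1)"
    using k below by (intro prod.cong) (auto simp: first_hit_factor_def)
  also have "\<dots> = h (x k)"
    using k by simp
  finally have hit: "(\<Prod>i\<in>{1..m}. first_hit_factor A h k i (x i)) = h (x k)" .
  have "(\<Sum>j\<in>{1..m}. \<Prod>i\<in>{1..m}. first_hit_factor A h j i (x i)) = h (x k)"
  proof -
    have "(\<Sum>j\<in>{1..m} - {k}. \<Prod>i\<in>{1..m}. first_hit_factor A h j i (x i)) = 0"
      by (intro sum.neutral ballI other) auto
    then show ?thesis
      using k(1) hit by (simp add: sum.remove[of _ k])
  qed
  also have "\<dots> \<le> (MAX i\<in>{1..m}. h (x i))"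
    using k by (intro Max_ge) auto
  finally show ?thesis .
qed

context prob_space
begin

lemma integrable_first_hit_factor:
  assumes "integrable M h" "A \<in> sets M"
  shows "integrable M (first_hit_factor A h j i)"
proof -
  have "integrable M (\<lambda>y. indicator A y * h y)"
    using integrable_mult_indicator[OF assms(2,1)] by simp
  moreover have "integrable M (\<lambda>y. 1 - indicator A y :: real)"
    using assms by (intro Bochner_Integration.integrable_diff) (auto simp: emeasure_eq_measure)
  ultimately show ?thesis
    unfolding first_hit_factor_def by (cases i j rule: linorder_cases) simp_all
qed

lemma integral_first_hit_factor:
  assumes "A \<in> sets M"
  shows "(\<integral>y. first_hit_factor A h j i y \<partial>M) =
    (if i < j then 1 - prob A else if i = j then LINT y:A|M. h y else 1)"
proof -
  have "(\<integral>y. 1 - indicator A y \<partial>M) = 1 - prob A"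
    using assms by (subst Bochner_Integration.integral_diff)
      (auto simp: emeasure_eq_measure prob_space)
  then show ?thesis
    by (cases i j rule: linorder_cases)
      (simp_all add: first_hit_factor_def set_lebesgue_integral_def prob_space)
qed

text \<open>The \<open>j - 1\<close> coordinates before the first hit each contribute the probability of missing \<open>A\<close>.\<close>

lemma integral_prod_first_hit_factor:
  assumes "integrable M h" "A \<in> sets M" "j \<in> {1..m}"
  shows "(\<integral>x. (\<Prod>i\<in>{1..m}. first_hit_factor A h j i (x i)) \<partial>(Pi\<^sub>M {1..m} (\<lambda>_. M))) =
    (1 - prob A) ^ (j - 1) * (LINT y:A|M. h y)"
proof -
  interpret P: product_sigma_finite "\<lambda>_::nat. M" ..
  have "(\<integral>x. (\<Prod>i\<in>{1..m}. first_hit_factor A h j i (x i)) \<partial>(Pi\<^sub>M {1..m} (\<lambda>_. M))) =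
      (\<Prod>i\<in>{1..m}. if i < j then 1 - prob A else if i = j then LINT y:A|M. h y else 1)"
    using assms by (subst P.product_integral_prod)
      (simp_all add: integrable_first_hit_factor integral_first_hit_factor)
  also have "\<dots> = (\<Prod>i\<in>insert j {1..<j}. if i < j then 1 - prob A else LINT y:A|M. h y)"
    using assms(3) by (intro prod.mono_neutral_cong_right) auto
  also have "\<dots> = (1 - prob A) ^ (j - 1) * (LINT y:A|M. h y)"
    by simp
  finally show ?thesis .
qed

text \<open>Each coordinate projection carries the product measure to \<open>M\<close>, so it preserves integrability.\<close>

lemma integrable_Max_components:
  fixes h :: "'a \<Rightarrow> real"
  assumes "integrable M h" "finite I" "I \<noteq> {}"
  shows "integrable (Pi\<^sub>M I (\<lambda>_. M)) (\<lambda>x. MAX i\<in>I. h (x i))"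
proof (rule integrable_MAX[OF assms(2,3)])
  fix k assume k: "k \<in> I"
  have "distr (Pi\<^sub>M I (\<lambda>_. M)) M (\<lambda>x. x k) = M"
    using k by (intro distr_PiM_component prob_space_axioms)
  then show "integrable (Pi\<^sub>M I (\<lambda>_. M)) (\<lambda>x. h (x k))"
    using assms(1) k by (intro integrable_distr[of "\<lambda>x. x k" _ M]) simp_all
qed

end

theorem theorem3:
  fixes M :: "'a measure"
    and f :: "'a \<Rightarrow> 'b::{real_normed_field, banach, second_countable_topology}"
    and m :: nat and \<Delta> :: "'a set"
  assumes "prob_space M"
    and "integrable M f"
    and "m \<ge> 1"
    and "\<Delta> \<in> sets M"
    and "measure M \<Delta> > 0"
  shows "integral_uniform_norm M m f \<ge>
    (1 - (1 - measure M \<Delta>) ^ m) * (1 / measure M \<Delta> * (LINT x:\<Delta>|M. norm (f x)))"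
proof -
  interpret prob_space M by fact
  interpret P: product_sigma_finite "\<lambda>_::nat. M" ..
  let ?h = "\<lambda>y. norm (f y)"
  let ?P = "Pi\<^sub>M {1..m} (\<lambda>_. M)"
  let ?g = "\<lambda>j x. \<Prod>i\<in>{1..m}. first_hit_factor \<Delta> ?h j i (x i)"
  have h: "integrable M ?h" using assms by simp
  have g: "integrable ?P (?g j)" for j
    using h assms by (intro P.product_integrable_prod integrable_first_hit_factor) auto
  have "(1 - (1 - prob \<Delta>) ^ m) * (1 / prob \<Delta> * (LINT x:\<Delta>|M. ?h x)) =
      (\<Sum>j<m. (1 - prob \<Delta>) ^ j) * (LINT x:\<Delta>|M. ?h x)"
    using \<open>prob \<Delta> > 0\<close> by (subst one_diff_power_eq) simp
  also have "\<dots> = (\<Sum>j\<in>{1..m}. (1 - prob \<Delta>) ^ (j - 1) * (LINT x:\<Delta>|M. ?h x))"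
    unfolding sum_distrib_right
    by (rule sum.reindex_bij_witness[of _ "\<lambda>j. j - 1" Suc]) auto
  also have "\<dots> = (\<Sum>j\<in>{1..m}. \<integral>x. ?g j x \<partial>?P)"
    by (intro sum.cong refl integral_prod_first_hit_factor[symmetric] h \<open>\<Delta> \<in> sets M\<close>)
  also have "\<dots> = (\<integral>x. (\<Sum>j\<in>{1..m}. ?g j x) \<partial>?P)"
    using g by (simp add: Bochner_Integration.integral_sum)
  also have "\<dots> \<le> (\<integral>x. (MAX i\<in>{1..m}. ?h (x i)) \<partial>?P)"
    using g h assms
    by (intro integral_mono Bochner_Integration.integrable_sum integrable_Max_components
        sum_first_hit_le_Max) auto
  finally show ?thesis
    unfolding integral_uniform_norm_def .
qed

end
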